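(* Let $\mu$ be a Borel probability measure on $2^\omega$, let $s\in[0,1)$, let $F\subseteq 2^\omega\times\omega^\omega$ and $A=\{x\in2^\omega:\exists y\in\omega^\omega\ (x,y)\in F\}$. If player I has a winning strategy in the unfolded measure game $G_{\text{unfolded}}(s,F)$, then player I has a winning strategy in the measure game $G(s,A)$; and if player II has a winning strategy in $G_{\text{unfolded}}(s,F)$, then player II has a winning strategy in $G(s,A)$.
   Context: $2^\omega$ is the space of infinite binary sequences, $\omega^\omega$ the Baire space; for $t\in2^{<\omega}$, $N_t=\{x\in2^\omega:t\subseteq x\}$, $t^\frown i$ is $t$ extended by $i$. Measure game $G(s,A)$ ($A\subseteq 2^\omega$): in round $n$, after II has played $t=x_0\dots x_{n-1}$, I plays $(m_{t^\frown0},m_{t^\frown1})$, then II plays $x_n$; $m_\emptyset=m_0+m_1$. I must obey: all $m_t$ rational; $m_0+m_1>s$; $0\le m_t\le\mu(N_t)$; $\mu(N_t)>0\Rightarrow m_t<\mu(N_t)$; $m_{t^\frown0}+m_{t^\frown1}=m_t$. II must obey: $x_n\in\{0,1\}$ and $m_{x_0\dots x_n}\ne0$. First rule-violator loses; otherwise II wins iff $(x_0,x_1,\dots)\in A$. The unfolded game $G_{\text{unfolded}}(s,F)$ is played like $G(s,A)$ except that in each round II may, in addition to $x_n$, play a natural number; the natural numbers played by II, in order, are $y_0,y_1,\dots$. Rules for I: all $m_t$ rational with $m_t\ge0$; $m_0+m_1>s$; $\mu(N_t)>0\Rightarrow m_t<\mu(N_t)$; $m_{t^\frown0}+m_{t^\frown1}=m_t$.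 Rules for II: $x_n\in\{0,1\}$; $m_{x_0\dots x_n}\ne0$; and for every $i$ there is a round $k_i$ in which II plays $(x_{k_i},y_i)$ with $y_i\in\omega$ (i.e., II plays infinitely many $y$-digits). If both players follow the rules, II wins iff $(x,y)\in F$ where $x=(x_n)$, $y=(y_i)$; otherwise the player who violated the rules loses.
   Formalization: In the unfolded game player I must also obey m_t ≤ μ(N_t), as in G(s,A); without this rule the claim for player I fails, e.g. for μ the point mass at 000…, s = 0, F = {000…}×ω^ω, where I wins the unfolded game by putting mass on the null set N_1. *)

theory Defs
  imports "HOL-Probability.Probability" "HOL-Library.Infinite_Set"
begin

text \<open>
  Games of length \<open>\<omega>\<close>: in round \<open>n\<close> player I plays \<open>fst (p n)\<close>, then player II
  plays \<open>snd (p n)\<close>. A strategy sees the whole position. \<open>W\<close> is the set of runs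
  won by II; all other runs are won by I.
\<close>

definition I_has_winning_strategy :: "((nat \<Rightarrow> 'a \<times> 'b) \<Rightarrow> bool) \<Rightarrow> bool" where
  "I_has_winning_strategy W \<longleftrightarrow>
     (\<exists>\<sigma> :: ('a \<times> 'b) list \<Rightarrow> 'a.
        \<forall>p. (\<forall>n. fst (p n) = \<sigma> (map p [0..<n])) \<longrightarrow> \<not> W p)"

definition II_has_winning_strategy :: "((nat \<Rightarrow> 'a \<times> 'b) \<Rightarrow> bool) \<Rightarrow> bool" where
  "II_has_winning_strategy W \<longleftrightarrow>
     (\<exists>\<tau> :: ('a \<times> 'b) list \<Rightarrow> 'a \<Rightarrow> 'b.
        \<forall>p. (\<forall>n. snd (p n) = \<tau> (map p [0..<n]) (fst (p n))) \<longrightarrow> W p)"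

text \<open>
  \<open>okI n\<close> and \<open>okII n\<close> say that the move of I, respectively II, in round \<open>n\<close> obeys the
  rules. The first player to break a rule loses (I moves before II in each round); if
  no move breaks a rule, II wins iff \<open>P\<close>.
\<close>

definition II_wins_run :: "(nat \<Rightarrow> bool) \<Rightarrow> (nat \<Rightarrow> bool) \<Rightarrow> bool \<Rightarrow> bool" where
  "II_wins_run okI okII P \<longleftrightarrow>
     (\<exists>n. \<not> okI n \<and> (\<forall>k<n. okI k \<and> okII k)) \<or> ((\<forall>n. okI n \<and> okII n) \<and> P)"

definition cyl :: "bool list \<Rightarrow> (nat \<Rightarrow> bool) set" where
  "cyl t = {x. \<forall>i<length t. x i = t ! i}"

definition restr :: "(nat \<Rightarrow> bool) \<Rightarrow> nat \<Rightarrow> bool list" where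
  "restr x n = map x [0..<n]"

text \<open>
  \<open>m n\<close> is the pair played by I in round \<open>n\<close> and \<open>x n\<close> the bit played by II, so
  \<open>m n\<close> is the pair of masses of the two one-bit extensions of \<open>restr x n\<close>;
  \<open>mass m x n\<close> is the mass of \<open>restr x n\<close> itself.
\<close>

fun mass :: "(nat \<Rightarrow> real \<times> real) \<Rightarrow> (nat \<Rightarrow> bool) \<Rightarrow> nat \<Rightarrow> real" where
  "mass m x 0 = fst (m 0) + snd (m 0)"
| "mass m x (Suc n) = (if x n then snd (m n) else fst (m n))"

definition mass_ok :: "(nat \<Rightarrow> bool) measure \<Rightarrow> bool list \<Rightarrow> real \<Rightarrow> bool" where
  "mass_ok \<mu> t r \<longleftrightarrow>
     r \<in> \<rat> \<and> 0 \<le> r \<and> r \<le> measure \<mu> (cyl t) \<and>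
     (measure \<mu> (cyl t) > 0 \<longrightarrow> r < measure \<mu> (cyl t))"

definition I_obeys ::
  "(nat \<Rightarrow> bool) measure \<Rightarrow> real \<Rightarrow> (nat \<Rightarrow> real \<times> real) \<Rightarrow> (nat \<Rightarrow> bool) \<Rightarrow> nat \<Rightarrow> bool" where
  "I_obeys \<mu> s m x n \<longleftrightarrow>
     mass_ok \<mu> (restr x n) (mass m x n) \<and>
     mass_ok \<mu> (restr x n @ [False]) (fst (m n)) \<and>
     mass_ok \<mu> (restr x n @ [True]) (snd (m n)) \<and>
     fst (m n) + snd (m n) = mass m x n \<and>
     (n = 0 \<longrightarrow> fst (m 0) + snd (m 0) > s)"

definition II_obeys :: "(nat \<Rightarrow> real \<times> real) \<Rightarrow> (nat \<Rightarrow> bool) \<Rightarrow> nat \<Rightarrow> bool" where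
  "II_obeys m x n \<longleftrightarrow> mass m x (Suc n) \<noteq> 0"

definition measure_game ::
  "(nat \<Rightarrow> bool) measure \<Rightarrow> real \<Rightarrow> (nat \<Rightarrow> bool) set \<Rightarrow>
   (nat \<Rightarrow> (real \<times> real) \<times> bool) \<Rightarrow> bool" where
  "measure_game \<mu> s A p \<longleftrightarrow>
     (let m = (\<lambda>n. fst (p n)); x = (\<lambda>n. snd (p n))
      in II_wins_run (I_obeys \<mu> s m x) (II_obeys m x) (x \<in> A))"

text \<open>
  In the unfolded game II plays a bit and possibly a natural number. The requirement
  that II play infinitely many numbers can only fail at the end of a run, after any
  violation of a rule in a single round, so it belongs to the payoff.

  Player I has the same rules as in the measure game, including the upper bound
  \<open>m\<^sub>t \<le> \<mu>(N\<^sub>t)\<close>, i.e. \<open>m\<^sub>t = 0\<close> if \<open>\<mu>(N\<^sub>t) = 0\<close>. If I could put mass on null sets,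
  I could force II into a null set: for \<open>\<mu>\<close> the point mass at \<open>0\<^sup>\<omega>\<close> and
  \<open>F = {0\<^sup>\<omega>} \<times> \<omega>\<^sup>\<omega>\<close>, I would win the unfolded game, but II wins the measure game.
\<close>

definition y_rounds :: "(nat \<Rightarrow> nat option) \<Rightarrow> nat set" where
  "y_rounds d = {k. d k \<noteq> None}"

definition y_digits :: "(nat \<Rightarrow> nat option) \<Rightarrow> nat \<Rightarrow> nat" where
  "y_digits d i = the (d (enumerate (y_rounds d) i))"

definition unfolded_measure_game ::
  "(nat \<Rightarrow> bool) measure \<Rightarrow> real \<Rightarrow> ((nat \<Rightarrow> bool) \<times> (nat \<Rightarrow> nat)) set \<Rightarrow>
   (nat \<Rightarrow> (real \<times> real) \<times> (bool \<times> nat option)) \<Rightarrow> bool" where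
  "unfolded_measure_game \<mu> s F p \<longleftrightarrow>
     (let m = (\<lambda>n. fst (p n)); x = (\<lambda>n. fst (snd (p n))); d = (\<lambda>n. snd (snd (p n)))
      in II_wins_run (I_obeys \<mu> s m x) (II_obeys m x)
           (infinite (y_rounds d) \<and> (x, y_digits d) \<in> F))"

end

theory Submission
  imports Defs
begin

text \<open>
  The implication for II is obtained by hiding the digits. For I, let a winning strategy in the
  unfolded game be given. At a position \<open>w\<close> where II stops playing digits, the strategy distributes
  the mass \<open>M w\<close> over the cylinders below; the points at which the ratio of this mass to \<open>\<mu>\<close> stays
  above \<open>\<epsilon>\<close> form a closed set of measure at least \<open>M w - \<epsilon>\<close>. Among them, the points that leave all
  sets of this kind (for \<open>\<epsilon> / 2\<close>), no matter when the next digit is played, miss a fixed proportion of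
  every small cylinder that they meet, so they form a null set. There are only countably many positions
  and digits, so removing an open set of small measure leaves a closed set of measure \<open>> s\<close>
  in which II could play any sequence \<open>y\<close> without breaking a rule. As the strategy wins, this closed set
  is disjoint from \<open>A\<close>, and in \<open>G(s, A)\<close> player I keeps the mass on it.
\<close>

subsection \<open>Cantor space\<close>

lemma length_restr [simp]: "length (restr x n) = n"
  by (simp add: restr_def)

lemma mem_cyl_iff: "x \<in> cyl t \<longleftrightarrow> restr x (length t) = t"
  unfolding cyl_def restr_def list_eq_iff_nth_eq by simp

lemma restr_mem_cyl [simp]: "x \<in> cyl (restr x n)"
  by (simp add: mem_cyl_iff)

lemma restr_Suc: "restr x (Suc n) = restr x n @ [x n]"
  by (simp add: restr_def)

lemma restr_eq_iff: "restr x n = restr z n \<longleftrightarrow> (\<forall>i<n. x i = z i)"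
  by (auto simp: restr_def)

lemma cyl_Nil [simp]: "cyl [] = UNIV"
  by (simp add: cyl_def)

lemma cyl_snoc: "cyl (t @ [b]) = {x \<in> cyl t. x (length t) = b}"
  by (rule set_eqI) (simp add: mem_cyl_iff restr_Suc)

lemma cyl_split: "cyl t = cyl (t @ [False]) \<union> cyl (t @ [True])"
  by (auto simp: cyl_snoc)

lemma cyl_split_disjoint: "cyl (t @ [False]) \<inter> cyl (t @ [True]) = {}"
  by (auto simp: cyl_snoc)

lemma open_cyl: "open (cyl t)"
proof -
  have "cyl t = {x. \<forall>i\<in>{..<length t}. x i \<in> {t ! i}}"
    by (auto simp: cyl_def)
  also have "open \<dots>"
    by (rule product_topology_basis') (simp_all add: discrete_topology_class.open_discrete)
  finally show ?thesis .
qed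

lemma open_restr: "open {x. P (restr x n)}"
proof -
  have "{x. P (restr x n)} = (\<Union>t\<in>{t. length t = n \<and> P t}. cyl t)"
    by (auto simp: mem_cyl_iff)
  then show ?thesis
    by (simp add: open_UN open_cyl)
qed

lemma closed_restr: "closed {x. P (restr x n)}"
  using open_restr[of "\<lambda>t. \<not> P t" n] unfolding closed_def Collect_neg_eq .

text \<open>A basic open box constrains only finitely many coordinates, so any \<open>n\<close>
  beyond all of them works.\<close>

lemma open_contains_cyl:
  assumes "open U" "x \<in> U"
  shows "\<exists>n. cyl (restr x n) \<subseteq> U"
proof -
  have "openin (product_topology (\<lambda>i. euclidean) UNIV) U"
    using assms(1) unfolding open_fun_def .
  from product_topology_open_contains_basis[OF this assms(2)]
  obtain X where X: "x \<in> (\<Pi>\<^sub>E i\<in>UNIV. X i)" "finite {i. X i \<noteq> (UNIV :: bool set)}"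
      "(\<Pi>\<^sub>E i\<in>UNIV. X i) \<subseteq> U"
    unfolding topspace_euclidean by blast
  obtain n where n: "\<forall>i\<in>{i. X i \<noteq> UNIV}. i < n"
    using finite_nat_set_iff_bounded[THEN iffD1, OF X(2)] ..
  have "cyl (restr x n) \<subseteq> (\<Pi>\<^sub>E i\<in>UNIV. X i)"
  proof
    fix z assume z: "z \<in> cyl (restr x n)"
    have "z i \<in> X i" for i
    proof (cases "i < n")
      case True
      then have "z i = x i" using z by (simp add: mem_cyl_iff restr_eq_iff)
      moreover have "x i \<in> X i" using X(1) by (rule PiE_mem) simp
      ultimately show ?thesis by simp
    qed (use n in auto)
    then show "z \<in> (\<Pi>\<^sub>E i\<in>UNIV. X i)" by (simp add: PiE_UNIV_domain)
  qed
  from this X(3) have "cyl (restr x n) \<subseteq> U" by (rule order_trans)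
  then show ?thesis ..
qed

section \<open>Approximation of sets by unions of cylinders\<close>

definition level_interior :: "(nat \<Rightarrow> bool) set \<Rightarrow> nat \<Rightarrow> (nat \<Rightarrow> bool) set" where
  "level_interior U n = {x. cyl (restr x n) \<subseteq> U}"

lemma open_level_interior: "open (level_interior U n)"
  unfolding level_interior_def by (rule open_restr)

lemma level_interior_subset: "level_interior U n \<subseteq> U"
  unfolding level_interior_def using restr_mem_cyl by blast

lemma incseq_level_interior: "incseq (level_interior U)"
proof (rule incseq_SucI)
  fix n
  show "level_interior U n \<subseteq> level_interior U (Suc n)"
    unfolding level_interior_def restr_Suc cyl_snoc by blast
qed

text \<open>Each level is a disjoint union of finitely many cylinders, so estimates on cylinders
  pass to levels by summation and to \<open>U\<close> by continuity of the measure.\<close>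

lemma UN_level_interior:
  assumes "open U"
  shows "(\<Union>n. level_interior U n) = U"
proof
  show "U \<subseteq> (\<Union>n. level_interior U n)"
    using open_contains_cyl[OF assms] by (auto simp: level_interior_def)
qed (use level_interior_subset in blast)

text \<open>Preimages of cylinders are given by finitely many coordinate inequalities, and an open
  set is a union of cylinders, of which there are only countably many.\<close>

lemma borel_measurable_threshold:
  "(\<lambda>z n. z n > (1/2::real)) \<in> borel_measurable (borel :: (nat \<Rightarrow> real) measure)"
proof (rule borel_measurableI)
  fix U :: "(nat \<Rightarrow> bool) set"
  assume "open U"
  let ?g = "\<lambda>z n. z n > (1/2::real)"
  have "U = (\<Union>t\<in>{t. cyl t \<subseteq> U}. cyl t)"
    using open_contains_cyl[OF \<open>open U\<close>] restr_mem_cyl by blast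
  then have "?g -` U = (\<Union>t\<in>{t. cyl t \<subseteq> U}. ?g -` cyl t)"
    by (metis vimage_UN)
  also have "\<dots> \<in> sets borel"
  proof (rule sets.countable_UN'')
    fix t
    have [measurable]: "(\<lambda>z :: nat \<Rightarrow> real. z i) \<in> borel_measurable borel" for i
      by (intro borel_measurable_continuous_onI continuous_on_product_coordinates)
    have "?g -` cyl t = {z \<in> space borel. \<forall>i\<in>{..<length t}. (1/2 < z i) = t ! i}"
      by (auto simp: cyl_def)
    also have "\<dots> \<in> sets borel" by measurable
    finally show "?g -` cyl t \<in> sets borel" .
  qed auto
  finally show "?g -` U \<inter> space borel \<in> sets borel" by simp
qed

text \<open>The type \<^typ>\<open>bool\<close> carries no metric, so outer regularity is pulled back
  from the Polish space of real sequences.\<close>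
lemma cantor_outer_regular:
  fixes \<mu> :: "(nat \<Rightarrow> bool) measure"
  assumes "finite_measure \<mu>" and sets_\<mu>: "sets \<mu> = sets borel"
    and B: "B \<in> sets borel" and "0 < e"
  shows "\<exists>U. open U \<and> B \<subseteq> U \<and> measure \<mu> U < measure \<mu> B + e"
proof -
  interpret finite_measure \<mu> by fact
  \<comment> \<open>\<open>f\<close> is a continuous embedding and \<open>g\<close> a Borel left
    inverse, so the preimage of \<open>B\<close> under \<open>g\<close> is a Borel set that
    \<open>f\<close> pulls back to exactly \<open>B\<close>.\<close>
  define f :: "(nat \<Rightarrow> bool) \<Rightarrow> nat \<Rightarrow> real" where "f x n = of_bool (x n)" for x n
  define g :: "(nat \<Rightarrow> real) \<Rightarrow> nat \<Rightarrow> bool" where "g z n \<longleftrightarrow> z n > 1/2" for z n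
  have gf: "g (f x) = x" for x by (rule ext) (simp add: f_def g_def)
  have cf: "continuous_on UNIV f"
    unfolding f_def
    by (intro continuous_on_coordinatewise_then_product
        continuous_on_compose2[OF Topological_Spaces.continuous_on_discrete continuous_on_product_coordinates]) auto
  have mf: "f \<in> measurable \<mu> borel"
    using borel_measurable_continuous_onI[OF cf] measurable_cong_sets[OF sets_\<mu> refl] by blast
  have mg: "g \<in> borel_measurable borel"
    using borel_measurable_threshold by (simp add: g_def[abs_def])
  define N where "N = distr \<mu> borel f"
  have sp: "space \<mu> = UNIV" using sets_eq_imp_space_eq[OF sets_\<mu>] by simp
  have N: "emeasure N X = emeasure \<mu> (f -` X)" if "X \<in> sets borel" for X
    using that by (simp add: N_def emeasure_distr[OF mf] sp)
  have gB: "g -` B \<in> sets borel" using measurable_sets[OF mg B] by simp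
  have fgB: "f -` (g -` B) = B" using gf by auto
  have plus: "emeasure \<mu> B + ennreal e = ennreal (measure \<mu> B + e)"
    using \<open>0 < e\<close> by (simp add: emeasure_eq_measure)
  have "emeasure N (g -` B) = (INF U\<in>{U. g -` B \<subseteq> U \<and> open U}. emeasure N U)"
    by (rule outer_regular) (auto simp: N N_def gB emeasure_distr[OF mf])
  moreover have "emeasure N (g -` B) < emeasure \<mu> B + ennreal e"
    using \<open>0 < e\<close> by (simp add: N gB fgB plus emeasure_eq_measure ennreal_less_iff)
  ultimately obtain V where V: "open V" "g -` B \<subseteq> V" "emeasure N V < emeasure \<mu> B + ennreal e"
    by (auto simp: INF_less_iff)
  show ?thesis
  proof (intro exI conjI)
    show "open (f -` V)" using cf V(1) by (simp add: continuous_on_open_vimage)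
    show "B \<subseteq> f -` V" using V(2) fgB by blast
    show "measure \<mu> (f -` V) < measure \<mu> B + e"
      using V(1,3) unfolding plus by (simp add: N emeasure_eq_measure ennreal_less_iff)
  qed
qed

text \<open>Compare \<open>D\<close> with an open superset of almost the same measure, which is a union of cylinders.\<close>
lemma cantor_porous_null:
  fixes \<mu> :: "(nat \<Rightarrow> bool) measure"
  assumes "finite_measure \<mu>" and sets_\<mu>: "sets \<mu> = sets borel"
    and D: "D \<in> sets borel" and c: "0 < c" "c \<le> 1"
    and thin: "\<And>x n. x \<in> D \<Longrightarrow> k \<le> n \<Longrightarrow>
      measure \<mu> (D \<inter> cyl (restr x n)) \<le> (1 - c) * measure \<mu> (cyl (restr x n))"
  shows "measure \<mu> D = 0"
proof -
  interpret finite_measure \<mu> by fact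
  have [measurable]: "cyl t \<in> sets \<mu>" "D \<in> sets \<mu>" for t
    using open_cyl D sets_\<mu> by auto
  have le: "measure \<mu> D \<le> (1 - c) * (measure \<mu> D + e)" if e: "0 < e" for e
  proof -
    obtain U where U: "open U" "D \<subseteq> U" "measure \<mu> U < measure \<mu> D + e"
      using cantor_outer_regular[OF assms(1) sets_\<mu> D e] by blast
    have Usets [measurable]: "U \<in> sets \<mu>" "level_interior U n \<in> sets \<mu>" for n
      using U(1) open_level_interior sets_\<mu> by auto
    have level: "measure \<mu> (D \<inter> level_interior U n) \<le> (1 - c) * measure \<mu> U" if n: "k \<le> n" for n
    proof -
      let ?T = "{t. length t = n \<and> cyl t \<subseteq> U}"
      have fin: "finite ?T"
        using finite_lists_length_eq[of "UNIV :: bool set" n] by simp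
      have disj: "disjoint_family_on (\<lambda>t. X \<inter> cyl t) ?T" for X
        by (auto simp: disjoint_family_on_def mem_cyl_iff)
      have lev: "level_interior U n = (\<Union>t\<in>?T. cyl t)"
        by (auto simp: level_interior_def mem_cyl_iff)
      have "measure \<mu> (D \<inter> level_interior U n) = measure \<mu> (\<Union>t\<in>?T. D \<inter> cyl t)"
        by (simp add: lev)
      also have "\<dots> = (\<Sum>t\<in>?T. measure \<mu> (D \<inter> cyl t))"
        by (rule finite_measure_finite_Union[OF fin _ disj]) auto
      also have "\<dots> \<le> (\<Sum>t\<in>?T. (1 - c) * measure \<mu> (cyl t))"
      proof (rule sum_mono)
        fix t assume t: "t \<in> ?T"
        show "measure \<mu> (D \<inter> cyl t) \<le> (1 - c) * measure \<mu> (cyl t)"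
        proof (cases "D \<inter> cyl t = {}")
          case False
          then obtain x where "x \<in> D" "restr x n = t" using t by (auto simp: mem_cyl_iff)
          then show ?thesis using thin n by blast
        qed (use c in simp)
      qed
      also have "\<dots> = (1 - c) * (\<Sum>t\<in>?T. measure \<mu> (cyl t))"
        by (simp add: sum_distrib_left)
      also have "(\<Sum>t\<in>?T. measure \<mu> (cyl t)) = measure \<mu> (\<Union>t\<in>?T. cyl t)"
        by (rule finite_measure_finite_Union[symmetric, OF fin _ disj[of UNIV, simplified]]) auto
      also have "\<dots> \<le> measure \<mu> U"
        using lev level_interior_subset by (intro finite_measure_mono) auto
      finally show ?thesis using c by (simp add: mult_left_mono)
    qed
    have inc: "incseq (\<lambda>n. D \<inter> level_interior U n)"
      using incseq_level_interior[of U] by (auto simp: incseq_def)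
    have "(\<lambda>n. measure \<mu> (D \<inter> level_interior U n)) \<longlonglongrightarrow> measure \<mu> (\<Union>n. D \<inter> level_interior U n)"
      by (rule finite_Lim_measure_incseq) (use inc in auto)
    also have "(\<Union>n. D \<inter> level_interior U n) = D"
      using UN_level_interior[OF U(1)] U(2) by auto
    finally have "measure \<mu> D \<le> (1 - c) * measure \<mu> U"
      by (rule LIMSEQ_le_const2) (use level in auto)
    also have "\<dots> \<le> (1 - c) * (measure \<mu> D + e)"
      using U(3) c by (intro mult_left_mono) auto
    finally show ?thesis .
  qed
  show ?thesis
  proof (rule ccontr)
    assume "measure \<mu> D \<noteq> 0"
    then have pos: "0 < measure \<mu> D" by (simp add: zero_less_measure_iff)
    \<comment> \<open>The error \<open>c * measure \<mu> D\<close> yields the factor (1 - c)(1 + c),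
      which is below 1.\<close>
    have "measure \<mu> D \<le> (1 - c) * (measure \<mu> D + c * measure \<mu> D)"
      using le[of "c * measure \<mu> D"] pos c by simp
    also have "\<dots> = measure \<mu> D - c\<^sup>2 * measure \<mu> D"
      by (simp add: algebra_simps power2_eq_square)
    finally show False using pos c by (simp add: zero_less_mult_iff mult_le_0_iff)
  qed
qed

subsection \<open>Strategies in the measure game\<close>

text \<open>The conditions \<open>u < a\<close> and \<open>m - u < b\<close> are compatible because
  \<open>m < a + b\<close>. A zero capacity forces mass 0 on its side, hence the exception at
  0.\<close>

lemma rational_split:
  fixes m a b :: real
  assumes "m \<in> \<rat>" "0 \<le> m" "0 \<le> a" "0 \<le> b" "m < a + b \<or> m = 0"
  shows "\<exists>u v. u \<in> \<rat> \<and> v \<in> \<rat> \<and> u + v = m \<and> 0 \<le> u \<and> 0 \<le> v \<and>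
    (u < a \<or> u = 0) \<and> (v < b \<or> v = 0)"
proof -
  consider "m = 0" | "0 < m" "a = 0" | "0 < m" "b = 0" | "0 < m" "0 < a" "0 < b"
    using assms by linarith
  then show ?thesis
  proof cases
    case 1 then show ?thesis by (intro exI[of _ 0]) auto
  next
    case 2 then show ?thesis using assms by (intro exI[of _ 0] exI[of _ m]) auto
  next
    case 3 then show ?thesis using assms by (intro exI[of _ m] exI[of _ 0]) auto
  next
    case 4
    then have "max 0 (m - b) < min a m" using assms by auto
    then obtain u where "u \<in> \<rat>" "max 0 (m - b) < u" "u < min a m"
      using Rats_dense_in_real by blast
    then show ?thesis using assms(1) by (intro exI[of _ u] exI[of _ "m - u"]) auto
  qed
qed

text \<open>I keeps the mass at \<open>t\<close> strictly below the measure of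
  \<open>C \<inter> cyl t\<close>, or equal to 0. A run leaving \<open>C\<close> enters a cylinder
  disjoint from \<open>C\<close>, where only mass 0 is left and II has no legal move.\<close>

lemma I_wins_if_closed_set:
  assumes "prob_space \<mu>" and sets_\<mu>: "sets \<mu> = sets borel"
    and C: "closed C" "C \<inter> A = {}" "s < measure \<mu> C"
    and "0 \<le> s"
  shows "I_has_winning_strategy (measure_game \<mu> s A)"
proof -
  interpret prob_space \<mu> by fact
  have [measurable]: "cyl t \<in> sets \<mu>" "C \<in> sets \<mu>" for t
    using open_cyl C(1) sets_\<mu> by auto
  define c where "c t = measure \<mu> (C \<inter> cyl t)" for t
  have c_nonneg: "0 \<le> c t" for t by (simp add: c_def)
  have c_le: "c t \<le> measure \<mu> (cyl t)" for t
    unfolding c_def by (rule finite_measure_mono) auto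
  have c_split: "c t = c (t @ [False]) + c (t @ [True])" for t
  proof -
    have "C \<inter> cyl t = (C \<inter> cyl (t @ [False])) \<union> (C \<inter> cyl (t @ [True]))"
      using cyl_split[of t] by blast
    moreover have "(C \<inter> cyl (t @ [False])) \<inter> (C \<inter> cyl (t @ [True])) = {}"
      using cyl_split_disjoint[of t] by blast
    ultimately show ?thesis
      unfolding c_def by (simp add: finite_measure_Union)
  qed
  \<comment> \<open>Starting strictly below the measure of \<open>C\<close> leaves room for rational
    masses and for the strict inequalities in the rules.\<close>
  obtain r where r: "r \<in> \<rat>" "s < r" "r < c []"
    using Rats_dense_in_real[OF C(3)] by (auto simp: c_def)
  define inv where "inv t m \<longleftrightarrow> m \<in> \<rat> \<and> 0 \<le> m \<and> (m < c t \<or> m = 0)" for t m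
  have "\<exists>uv. inv t m \<longrightarrow> fst uv + snd uv = m \<and> inv (t @ [False]) (fst uv) \<and> inv (t @ [True]) (snd uv)"
    for t m
  proof (cases "inv t m")
    case True
    then obtain u v where "inv (t @ [False]) u" "inv (t @ [True]) v" "u + v = m"
      using rational_split[of m "c (t @ [False])" "c (t @ [True])"] c_nonneg c_split[of t]
      unfolding inv_def by auto
    then show ?thesis by (intro exI[of _ "(u, v)"]) simp
  qed simp
  then obtain split where split: "inv t m \<Longrightarrow> fst (split t m) + snd (split t m) = m \<and>
      inv (t @ [False]) (fst (split t m)) \<and> inv (t @ [True]) (snd (split t m))" for t m
    by metis
  define \<sigma> :: "((real \<times> real) \<times> bool) list \<Rightarrow> real \<times> real" where
    "\<sigma> h = split (map snd h) (if h = [] then r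
      else if snd (last h) then snd (fst (last h)) else fst (fst (last h)))" for h
  have inv_ok: "mass_ok \<mu> t m" if "inv t m" for t m
    using that c_le[of t] unfolding inv_def mass_ok_def by auto
  have "\<not> measure_game \<mu> s A p" if p: "\<forall>n. fst (p n) = \<sigma> (map p [0..<n])" for p
  proof -
    define m where "m n = fst (p n)" for n
    define x where "x n = snd (p n)" for n
    have x: "map snd (map p [0..<n]) = restr x n" for n
      by (simp add: restr_def x_def)
    have inv_r: "inv [] r" using r \<open>0 \<le> s\<close> by (simp add: inv_def)
    have m0: "m 0 = split [] r" using p by (simp add: m_def \<sigma>_def)
    then have mass0: "mass m x 0 = r" using split[OF inv_r] by simp
    have mn: "m n = split (restr x n) (mass m x n)" for n
    proof (cases n)
      case 0 then show ?thesis using m0 mass0 by (simp add: restr_def)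
    next
      case (Suc k)
      have "m n = \<sigma> (map p [0..<n])" using p by (simp add: m_def)
      also have "\<dots> = split (restr x n) (mass m x n)"
        unfolding \<sigma>_def x using Suc by (simp add: m_def x_def)
      finally show ?thesis .
    qed
    have inv_n: "inv (restr x n) (mass m x n)" for n
    proof (induction n)
      case 0 then show ?case using inv_r mass0 by (simp add: restr_def)
    next
      case (Suc n)
      then show ?case using split[OF Suc] by (simp add: mn[of n] restr_Suc)
    qed
    have okI: "I_obeys \<mu> s m x n" for n
      using split[OF inv_n[of n]] inv_n[of n] mass0 r(2)
      unfolding I_obeys_def by (auto simp: mn[of n, symmetric] intro!: inv_ok)
    have "x \<notin> A" if okII: "\<forall>n. II_obeys m x n"
    proof -
      have "x \<in> C"
      proof (rule ccontr)
        assume "x \<notin> C"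
        then obtain n where n: "cyl (restr x n) \<subseteq> - C"
          using open_contains_cyl[of "- C" x] C(1) by (auto simp: closed_def)
        then have "C \<inter> cyl (restr x n) = {}" by blast
        then have "c (restr x n) = 0" by (simp add: c_def)
        then have "c (restr x (Suc n)) \<le> 0"
          using c_split[of "restr x n"] c_nonneg
          by (cases "x n") (auto simp: restr_Suc add_nonneg_eq_0_iff)
        then have "mass m x (Suc n) = 0" using inv_n[of "Suc n"] unfolding inv_def by linarith
        then show False using okII unfolding II_obeys_def by blast
      qed
      then show ?thesis using C(2) by blast
    qed
    then have "\<not> II_wins_run (I_obeys \<mu> s m x) (II_obeys m x) (x \<in> A)"
      using okI by (auto simp: II_wins_run_def)
    then show ?thesis by (simp add: measure_game_def m_def[abs_def] x_def[abs_def])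
  qed
  then show ?thesis unfolding I_has_winning_strategy_def by blast
qed

section \<open>Transfer of a winning strategy of II\<close>

lemma II_wins_run_mono:
  assumes "II_wins_run okI okII P" "P \<Longrightarrow> Q"
  shows "II_wins_run okI okII Q"
  using assms by (auto simp: II_wins_run_def)

lemma II_measure_game_if_II_unfolded:
  assumes "II_has_winning_strategy (unfolded_measure_game \<mu> s F)"
  shows "II_has_winning_strategy (measure_game \<mu> s {x. \<exists>y. (x, y) \<in> F})"
proof -
  obtain \<tau> where \<tau>: "\<And>q. (\<forall>n. snd (q n) = \<tau> (map q [0..<n]) (fst (q n))) \<Longrightarrow>
      unfolded_measure_game \<mu> s F q"
    using assms by (auto simp: II_has_winning_strategy_def)
  \<comment> \<open>\<open>H\<close> recomputes the unfolded position, digits included, from the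
    moves of I alone; the recorded bits agree with it along runs that follow the strategy.\<close>
  define H :: "((real \<times> real) \<times> bool) list \<Rightarrow> ((real \<times> real) \<times> (bool \<times> nat option)) list"
    where "H = foldl (\<lambda>h a. h @ [(fst a, \<tau> h (fst a))]) []"
  have "measure_game \<mu> s {x. \<exists>y. (x, y) \<in> F} p"
    if p: "\<forall>n. snd (p n) = fst (\<tau> (H (map p [0..<n])) (fst (p n)))" for p
  proof -
    define q where "q n = (fst (p n), \<tau> (H (map p [0..<n])) (fst (p n)))" for n
    have "map q [0..<n] = H (map p [0..<n])" for n
      by (induction n) (simp_all add: H_def q_def)
    then have "unfolded_measure_game \<mu> s F q"
      by (intro \<tau>) (simp add: q_def)
    moreover have "fst (snd (q n)) = snd (p n)" "fst (q n) = fst (p n)" for n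
      using p by (simp_all add: q_def)
    ultimately show ?thesis
      unfolding measure_game_def unfolded_measure_game_def Let_def
      by (auto elim: II_wins_run_mono)
  qed
  then show ?thesis
    unfolding II_has_winning_strategy_def
    by (intro exI[of _ "\<lambda>h a. fst (\<tau> (H h) a)"]) blast
qed

subsection \<open>Masses in the unfolded game\<close>

lemma enumerate_range_strict_mono:
  fixes r :: "nat \<Rightarrow> nat"
  assumes "strict_mono r"
  shows "enumerate (range r) n = r n"
proof (induction n)
  case 0
  have "(LEAST k. k \<in> range r) = r 0"
    using assms by (intro Least_equality) (auto simp: strict_mono_less_eq)
  then show ?case by (simp add: enumerate_0)
next
  case (Suc n)
  have "infinite (range r)"
    using assms by (simp add: range_inj_infinite strict_mono_imp_inj_on)
  then have "enumerate (range r) (Suc n) = (LEAST k. k \<in> range r \<and> r n < k)"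
    using Suc by (simp add: enumerate_Suc'')
  also have "\<dots> = r (Suc n)"
    using assms by (intro Least_equality) (auto simp: strict_mono_less_eq strict_mono_less)
  finally show ?case .
qed

text \<open>A position of the unfolded game is identified with the list of moves of II, the moves of I
  being given by a strategy. \<open>M w\<close> is the mass that I has assigned at that position.\<close>
locale mass_strategy = prob_space \<mu> for \<mu> :: "(nat \<Rightarrow> bool) measure" +
  fixes M :: "(bool \<times> nat option) list \<Rightarrow> real"
  assumes sets_\<mu>: "sets \<mu> = sets borel"
    and M_nonneg: "0 \<le> M w"
    and M_le: "M w \<le> measure \<mu> (cyl (map fst w))"
    and M_split: "M (w @ [(False, d)]) + M (w @ [(True, d)]) = M w"
    and M_digit: "M (w @ [(b, d)]) = M (w @ [(b, None)])"
begin

lemma cyl_sets [measurable]: "cyl t \<in> sets \<mu>"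
  using open_cyl sets_\<mu> by auto

text \<open>Meant for \<open>t\<close> extending the bits of \<open>w\<close>: the initial part of
  \<open>t\<close> is dropped without being compared with \<open>w\<close>.\<close>

definition wait :: "(bool \<times> nat option) list \<Rightarrow> bool list \<Rightarrow> (bool \<times> nat option) list" where
  "wait w t = w @ map (\<lambda>b. (b, None)) (drop (length w) t)"

text \<open>The digit accompanies the last bit of \<open>t\<close>, so \<open>t\<close> is the bit
  sequence of the new position whenever it properly extends that of \<open>w\<close>.\<close>

definition jump :: "(bool \<times> nat option) list \<Rightarrow> nat \<Rightarrow> bool list \<Rightarrow> (bool \<times> nat option) list" where
  "jump w j t = wait w (butlast t) @ [(last t, Some j)]"

text \<open>A quantitative version of the set where the density of the mass with respect to \<open>\<mu>\<close>
  is positive.\<close>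
definition dense_part :: "real \<Rightarrow> (bool \<times> nat option) list \<Rightarrow> (nat \<Rightarrow> bool) set" where
  "dense_part e w = {x \<in> cyl (map fst w).
     \<forall>i. e * measure \<mu> (cyl (restr x (length w + i))) < M (wait w (restr x (length w + i)))}"

text \<open>Finite stages decreasing to \<open>dense_part\<close>; they admit an induction on
  \<open>k\<close>.\<close>

definition dense_part_upto ::
    "real \<Rightarrow> nat \<Rightarrow> (bool \<times> nat option) list \<Rightarrow> (nat \<Rightarrow> bool) set" where
  "dense_part_upto e k w = {x \<in> cyl (map fst w).
     \<forall>i\<le>k. e * measure \<mu> (cyl (restr x (length w + i))) < M (wait w (restr x (length w + i)))}"

text \<open>No round is suitable for the next digit \<open>j\<close>. Only half the threshold is
  demanded after the digit, since at threshold \<open>e\<close> the new dense part need not fill a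
  fixed proportion of its cylinder.\<close>

definition stuck :: "real \<Rightarrow> (bool \<times> nat option) list \<Rightarrow> nat \<Rightarrow> (nat \<Rightarrow> bool) set" where
  "stuck e w j = {x \<in> dense_part e w.
     \<forall>i. x \<notin> dense_part (e / 2) (jump w j (restr x (Suc (length w + i))))}"

lemma wait_restr: "wait w (restr x (length w + i)) =
    w @ map (\<lambda>j. (x j, None)) [length w..<length w + i]"
  by (simp add: wait_def restr_def drop_map drop_upt comp_def)

lemma wait_map_fst [simp]: "wait w (map fst w) = w"
  by (simp add: wait_def)

lemma wait_restr_Suc:
  "wait w (restr x (length w + Suc i)) = wait w (restr x (length w + i)) @ [(x (length w + i), None)]"
  unfolding wait_restr by simp

lemma wait_restr_shift:
  "wait w (restr x (length w + Suc i)) =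
    wait (w @ [(x (length w), None)]) (restr x (length (w @ [(x (length w), None)]) + i))"
proof -
  have "[length w..<length w + Suc i] = length w # [Suc (length w)..<Suc (length w) + i]"
    by (simp add: upt_conv_Cons del: upt_Suc)
  then show ?thesis
    unfolding wait_restr by (simp del: upt_Suc)
qed

lemma jump_restr_Suc:
  "jump w j (restr x (Suc n)) = wait w (restr x n) @ [(x n, Some j)]"
  by (simp add: jump_def restr_Suc)

lemma map_fst_wait_restr:
  assumes "x \<in> cyl (map fst w)"
  shows "map fst (wait w (restr x (length w + i))) = restr x (length w + i)"
proof -
  have "map fst w = restr x (length w)" using assms by (simp add: mem_cyl_iff)
  then show ?thesis
    unfolding wait_restr by (simp add: comp_def restr_def upt_add_eq_append[of 0])
qed

section \<open>Measure of the dense part\<close>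

lemma dense_part_upto_0:
  "dense_part_upto e 0 w = (if e * measure \<mu> (cyl (map fst w)) < M w then cyl (map fst w) else {})"
  by (auto simp: dense_part_upto_def mem_cyl_iff)

lemma dense_part_upto_Suc:
  "dense_part_upto e (Suc k) w = (if e * measure \<mu> (cyl (map fst w)) < M w
    then dense_part_upto e k (w @ [(False, None)]) \<union> dense_part_upto e k (w @ [(True, None)]) else {})"
proof (rule set_eqI)
  fix x
  have all: "(\<forall>i\<le>Suc k. P i) \<longleftrightarrow> P 0 \<and> (\<forall>i\<le>k. P (Suc i))" for P
    by (metis Suc_le_mono le0 not0_implies_Suc)
  let ?w = "w @ [(x (length w), None)]"
  have "x \<in> dense_part_upto e (Suc k) w \<longleftrightarrow>
      e * measure \<mu> (cyl (map fst w)) < M w \<and> x \<in> dense_part_upto e k ?w"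
  proof (cases "x \<in> cyl (map fst w)")
    case True
    then have "restr x (length w) = map fst w" by (simp add: mem_cyl_iff)
    then show ?thesis
      using True unfolding dense_part_upto_def all wait_restr_shift
      by (simp add: cyl_snoc)
  next
    case False
    then show ?thesis by (simp add: dense_part_upto_def cyl_snoc)
  qed
  also have "x \<in> dense_part_upto e k ?w \<longleftrightarrow> x \<in> dense_part_upto e k (w @ [(False, None)]) \<union>
      dense_part_upto e k (w @ [(True, None)])"
    by (cases "x (length w)") (auto simp: dense_part_upto_def cyl_snoc)
  finally show "x \<in> dense_part_upto e (Suc k) w \<longleftrightarrow> x \<in> (if e * measure \<mu> (cyl (map fst w)) < M w
    then dense_part_upto e k (w @ [(False, None)]) \<union> dense_part_upto e k (w @ [(True, None)]) else {})"
    by simp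
qed

lemma dense_part_upto_subset: "dense_part_upto e k w \<subseteq> cyl (map fst w)"
  by (auto simp: dense_part_upto_def)

lemma dense_part_upto_sets [measurable]: "dense_part_upto e k w \<in> sets \<mu>"
  by (induction k arbitrary: w) (auto simp: dense_part_upto_0 dense_part_upto_Suc)

lemma measure_cyl_split:
  "measure \<mu> (cyl t) = measure \<mu> (cyl (t @ [False])) + measure \<mu> (cyl (t @ [True]))"
  by (subst cyl_split, rule finite_measure_Union) (auto simp: cyl_split_disjoint)

text \<open>The left side is additive over the two positions after a waiting round, so the bound
  propagates. If the threshold fails at \<open>w\<close>, the left side is at most 0.\<close>

lemma measure_dense_part_upto:
  assumes "0 \<le> e"
  shows "M w - e * measure \<mu> (cyl (map fst w)) \<le> measure \<mu> (dense_part_upto e k w)"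
proof (induction k arbitrary: w)
  case 0
  have "0 \<le> e * measure \<mu> (cyl (map fst w))" using assms by simp
  then show ?case using M_le[of w] by (simp add: dense_part_upto_0)
next
  case (Suc k)
  let ?u = "\<lambda>b. w @ [(b, None)]"
  have "M w - e * measure \<mu> (cyl (map fst w)) = (\<Sum>b\<in>{False, True}.
      M (?u b) - e * measure \<mu> (cyl (map fst (?u b))))"
    using M_split[of w None] measure_cyl_split[of "map fst w"] by (simp add: algebra_simps)
  also have "\<dots> \<le> (\<Sum>b\<in>{False, True}. measure \<mu> (dense_part_upto e k (?u b)))"
    by (intro sum_mono Suc)
  also have "\<dots> = measure \<mu> (dense_part_upto e k (?u False) \<union> dense_part_upto e k (?u True))"
    using dense_part_upto_subset[of e k "?u False"] dense_part_upto_subset[of e k "?u True"]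
      cyl_split_disjoint[of "map fst w"]
    by (subst finite_measure_Union) auto
  finally show ?case by (simp add: dense_part_upto_Suc)
qed

lemma dense_part_subset: "dense_part e w \<subseteq> cyl (map fst w)"
  by (auto simp: dense_part_def)

lemma closed_dense_part: "closed (dense_part e w)"
proof -
  have "dense_part e w = {x. restr x (length w) = map fst w} \<inter> (\<Inter>i. {x.
      (\<lambda>t. e * measure \<mu> (cyl t) < M (wait w t)) (restr x (length w + i))})"
    by (auto simp: dense_part_def mem_cyl_iff)
  moreover have "closed {x. restr x (length w) = map fst w}"
    by (rule closed_restr)
  moreover have "closed {x. (\<lambda>t. e * measure \<mu> (cyl t) < M (wait w t)) (restr x (length w + i))}" for i
    by (rule closed_restr)
  ultimately show ?thesis by (auto intro!: closed_Int closed_INT)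
qed

lemma dense_part_sets [measurable]: "dense_part e w \<in> sets \<mu>"
  using closed_dense_part sets_\<mu> by auto

lemma measure_dense_part:
  assumes "0 \<le> e"
  shows "M w - e * measure \<mu> (cyl (map fst w)) \<le> measure \<mu> (dense_part e w)"
proof -
  have dec: "decseq (\<lambda>k. dense_part_upto e k w)"
    by (rule decseq_SucI) (auto simp: dense_part_upto_def)
  have "(\<lambda>k. measure \<mu> (dense_part_upto e k w)) \<longlonglongrightarrow> measure \<mu> (\<Inter>k. dense_part_upto e k w)"
    by (rule finite_Lim_measure_decseq) (use dec in auto)
  also have "(\<Inter>k. dense_part_upto e k w) = dense_part e w"
    by (auto simp: dense_part_upto_def dense_part_def)
  finally show ?thesis
    by (rule LIMSEQ_le_const) (use measure_dense_part_upto[OF assms] in auto)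
qed

section \<open>Stuck points form null sets\<close>

lemma stuck_sets [measurable]: "stuck e w j \<in> sets \<mu>"
proof -
  have "stuck e w j = dense_part e w - (\<Union>i. \<Union>t\<in>{t. length t = Suc (length w + i)}.
      cyl t \<inter> dense_part (e / 2) (jump w j t))"
    by (auto simp: stuck_def mem_cyl_iff)
  also have "\<dots> \<in> sets \<mu>"
    by (intro sets.Diff sets.countable_UN'' sets.Int) auto
  finally show ?thesis .
qed

text \<open>Let \<open>t\<close> be an initial segment of a stuck point, longer than
  \<open>w\<close>. The mass after waiting along \<open>t\<close> exceeds \<open>e\<close> times the
  measure of \<open>cyl t\<close>, and a digit in the last round does not change it. So the dense
  part for \<open>e / 2\<close> after that digit fills at least the proportion \<open>e / 2\<close>
  of \<open>cyl t\<close>, and it contains no stuck point.\<close>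

lemma stuck_null:
  assumes e: "0 < e" "e \<le> 1"
  shows "measure \<mu> (stuck e w j) = 0"
proof (rule cantor_porous_null[where c = "e / 2" and k = "Suc (length w)"])
  show "finite_measure \<mu>" by (rule finite_measure_axioms)
  show "sets \<mu> = sets borel" by (rule sets_\<mu>)
  show "stuck e w j \<in> sets borel" using stuck_sets sets_\<mu> by simp
  show "0 < e / 2" "e / 2 \<le> 1" using e by auto
next
  fix x n
  assume x: "x \<in> stuck e w j" and n: "Suc (length w) \<le> n"
  then obtain i where i: "n = Suc (length w + i)" by (auto simp: le_iff_add)
  let ?t = "restr x n" and ?q = "jump w j (restr x n)"
  have xw: "x \<in> cyl (map fst w)" using x by (auto simp: stuck_def dense_part_def)
  have q: "?q = wait w (restr x (length w + i)) @ [(x (length w + i), Some j)]"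
    by (simp add: i jump_restr_Suc)
  have fst_q: "map fst ?q = ?t"
    unfolding q map_append map_fst_wait_restr[OF xw] by (simp add: i restr_Suc)
  have "e * measure \<mu> (cyl ?t) < M (wait w ?t)"
    using x i unfolding stuck_def dense_part_def by (auto dest!: spec[of _ "Suc i"])
  also have "\<dots> = M ?q"
    using wait_restr_Suc[of w x i] unfolding q M_digit[of _ _ "Some j"] by (simp add: i)
  finally have "e / 2 * measure \<mu> (cyl ?t) \<le> measure \<mu> (dense_part (e / 2) ?q)"
    using measure_dense_part[of "e / 2" ?q] e fst_q by simp
  moreover have "measure \<mu> (stuck e w j \<inter> cyl ?t) + measure \<mu> (dense_part (e / 2) ?q) \<le>
      measure \<mu> (cyl ?t)"
  proof -
    have "z \<notin> dense_part (e / 2) ?q" if z: "z \<in> stuck e w j" "z \<in> cyl ?t" for z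
    proof -
      have "restr z n = ?t" using z(2) by (simp add: mem_cyl_iff)
      moreover have "z \<notin> dense_part (e / 2) (jump w j (restr z n))"
        using z(1) unfolding stuck_def i by blast
      ultimately show ?thesis by simp
    qed
    then have "(stuck e w j \<inter> cyl ?t) \<inter> dense_part (e / 2) ?q = {}" by blast
    then have "measure \<mu> (stuck e w j \<inter> cyl ?t) + measure \<mu> (dense_part (e / 2) ?q) =
        measure \<mu> (stuck e w j \<inter> cyl ?t \<union> dense_part (e / 2) ?q)"
      by (intro finite_measure_Union[symmetric]) auto
    also have "\<dots> \<le> measure \<mu> (cyl ?t)"
      using dense_part_subset[of "e / 2" ?q] fst_q by (intro finite_measure_mono) auto
    finally show ?thesis .
  qed
  ultimately show "measure \<mu> (stuck e w j \<inter> cyl ?t) \<le> (1 - e / 2) * measure \<mu> (cyl ?t)"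
    by (simp add: algebra_simps)
qed

text \<open>As \<open>x\<close> is never stuck, each next digit has a round after which
  \<open>x\<close> is in the dense part for half the threshold. The thresholds shrink but stay
  positive, so the mass never vanishes.\<close>

lemma play_digits:
  assumes e: "0 < e" and x: "x \<in> dense_part e []"
    and nstuck: "\<And>k w j. x \<notin> stuck (e / 2 ^ k) w j"
  shows "\<exists>d. infinite (y_rounds d) \<and> y_digits d = y \<and>
    (\<forall>n. 0 < M (map (\<lambda>n. (x n, d n)) [0..<n]))"
proof -
  \<comment> \<open>\<open>w k\<close> is the position just after the first \<open>k\<close>
    digits.\<close>
  have "\<exists>w. \<forall>k. ((k = 0 \<longrightarrow> w k = []) \<and> x \<in> dense_part (e / 2 ^ k) (w k)) \<and>
      (\<exists>i. w (Suc k) = jump (w k) (y k) (restr x (Suc (length (w k) + i))))"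
  proof (rule dependent_nat_choice)
    show "\<exists>w. (0 = (0::nat) \<longrightarrow> w = []) \<and> x \<in> dense_part (e / 2 ^ 0) w" using x by simp
  next
    fix w k
    assume "(k = 0 \<longrightarrow> w = []) \<and> x \<in> dense_part (e / 2 ^ k) w"
    then obtain i where "x \<in> dense_part (e / 2 ^ k / 2) (jump w (y k) (restr x (Suc (length w + i))))"
      using nstuck[of k w "y k"] by (auto simp: stuck_def)
    then show "\<exists>w'. ((Suc k = 0 \<longrightarrow> w' = []) \<and> x \<in> dense_part (e / 2 ^ Suc k) w') \<and>
        (\<exists>i. w' = jump w (y k) (restr x (Suc (length w + i))))"
      by (auto simp: mult.commute)
  qed
  then obtain w i where w0: "w 0 = []" and wd: "\<And>k. x \<in> dense_part (e / 2 ^ k) (w k)"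
    and wS: "\<And>k. w (Suc k) = jump (w k) (y k) (restr x (Suc (length (w k) + i k)))"
    by metis
  \<comment> \<open>Digit \<open>y k\<close> is played in round \<open>r k\<close>, after the
    possibly empty block of waiting rounds from \<open>l k\<close> on.\<close>
  define l where "l k = length (w k)" for k
  define r where "r k = l k + i k" for k
  have wS': "w (Suc k) = w k @ map (\<lambda>j. (x j, None)) [l k..<r k] @ [(x (r k), Some (y k))]" for k
    by (simp add: wS jump_restr_Suc wait_restr l_def r_def)
  have lS: "l (Suc k) = Suc (r k)" for k
    unfolding l_def wS' by (simp add: r_def flip: l_def)
  have l_less: "l k < l (Suc k)" for k by (simp add: lS r_def)
  then have l_mono: "strict_mono l" by (simp add: strict_mono_Suc_iff)
  have r_mono: "strict_mono r"
    unfolding strict_mono_Suc_iff by (auto simp: r_def[of "Suc _"] lS)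
  define d where "d n = (if n \<in> range r then Some (y (the_inv r n)) else None)" for n
  have inj_r: "inj r" using r_mono by (rule strict_mono_imp_inj_on)
  have d_r: "d (r k) = Some (y k)" for k by (simp add: d_def the_inv_f_f[OF inj_r])
  have d_None: "d n = None" if "l k \<le> n" "n < r k" for n k
  proof -
    have "r k' \<noteq> n" for k'
    proof (cases "k' < k")
      case True
      then have "l (Suc k') \<le> l k" by (intro strict_mono_leD[OF l_mono]) simp
      then show ?thesis using that(1) lS[of k'] by simp
    next
      case False
      then have "r k \<le> r k'" by (intro strict_mono_leD[OF r_mono]) simp
      then show ?thesis using that(2) by simp
    qed
    then show ?thesis by (auto simp: d_def)
  qed
  let ?b = "\<lambda>n. (x n, d n)"
  have seg: "map ?b [l k..<n] = map (\<lambda>j. (x j, None)) [l k..<n]" if "n \<le> r k" for k n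
    using that by (auto intro!: d_None)
  have wb: "w k = map ?b [0..<l k]" for k
  proof (induction k)
    case 0 then show ?case by (simp add: w0 l_def)
  next
    case (Suc k)
    have "[0..<l (Suc k)] = [0..<l k] @ [l k..<r k] @ [r k]"
      using upt_add_eq_append[of 0 "l k" "i k"] by (simp add: lS r_def)
    then show ?case using Suc seg[of "r k" k] d_r[of k] wS'[of k] by simp
  qed
  have pos: "0 < M (map ?b [0..<n])" for n
  proof -
    have ex: "\<exists>k. n < l (Suc k)"
      using strict_mono_imp_increasing[OF l_mono, of "Suc n"] Suc_le_lessD by blast
    \<comment> \<open>\<open>k\<close> counts the digits played before round \<open>n\<close>, so
      the position there is a waiting extension of \<open>w k\<close>.\<close>
    define k where "k = (LEAST k. n < l (Suc k))"
    have kS: "n < l (Suc k)" unfolding k_def using ex by (rule LeastI_ex)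
    have k: "l k \<le> n"
    proof (cases k)
      case 0 then show ?thesis by (simp add: l_def w0)
    next
      case (Suc k')
      then have "\<not> n < l (Suc k')" unfolding k_def by (intro not_less_Least) simp
      then show ?thesis using Suc by simp
    qed
    have "[0..<n] = [0..<l k] @ [l k..<n]"
      using upt_add_eq_append[of 0 "l k" "n - l k"] k by simp
    then have "map ?b [0..<n] = w k @ map (\<lambda>j. (x j, None)) [l k..<n]"
      using seg[of n k] kS lS[of k] wb[of k] by simp
    also have "\<dots> = wait (w k) (restr x (length (w k) + (n - l k)))"
      using k unfolding wait_restr by (simp add: l_def)
    finally have "map ?b [0..<n] = \<dots>" .
    moreover have "e / 2 ^ k * measure \<mu> (cyl (restr x (length (w k) + (n - l k)))) <
        M (wait (w k) (restr x (length (w k) + (n - l k))))"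
      using wd[of k] by (simp add: dense_part_def)
    moreover have "0 \<le> e / 2 ^ k * measure \<mu> (cyl (restr x (length (w k) + (n - l k))))"
      using e by simp
    ultimately show ?thesis by simp
  qed
  have rounds: "y_rounds d = range r" by (auto simp: y_rounds_def d_def)
  have "y_digits d = y"
    by (rule ext) (simp add: y_digits_def rounds enumerate_range_strict_mono[OF r_mono] d_r)
  moreover have "infinite (y_rounds d)"
    using inj_r by (simp add: rounds range_inj_infinite)
  ultimately show ?thesis using pos by blast
qed

text \<open>Over a point of the dense part that is never stuck, every \<open>y\<close> can be played
  with positive masses, so \<open>lose\<close> excludes all pairs. Removing an open superset of the
  stuck points keeps the set closed and costs arbitrarily little measure.\<close>

lemma closed_set_avoiding_projection:
  assumes s: "s < M []"
    and lose: "\<And>x d. (\<And>n. 0 < M (map (\<lambda>n. (x n, d n)) [0..<n])) \<Longrightarrow>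
      infinite (y_rounds d) \<Longrightarrow> (x, y_digits d) \<notin> F"
  shows "\<exists>C. closed C \<and> C \<inter> {x. \<exists>y. (x, y) \<in> F} = {} \<and> s < measure \<mu> C"
proof -
  \<comment> \<open>At most half of the surplus \<open>M [] - s\<close> is given up; the bound 1 is
    for \<open>stuck_null\<close>.\<close>
  define e where "e = min 1 ((M [] - s) / 2)"
  have e: "0 < e" "e \<le> 1" "s < M [] - e"
    using s by (auto simp: e_def min_def field_simps)
  have E: "s < measure \<mu> (dense_part e [])"
  proof -
    have "e * measure \<mu> UNIV \<le> e"
      using e(1) mult_left_mono[OF prob_le_1, of e] by simp
    moreover have "M [] - e * measure \<mu> UNIV \<le> measure \<mu> (dense_part e [])"
      using measure_dense_part[of e "[]"] e(1) by simp
    ultimately show ?thesis using e(3) by linarith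
  qed
  \<comment> \<open>Positions are finite lists over a countable type, so this is a countable union
    of null sets.\<close>
  define B where "B = (\<Union>k. \<Union>w. \<Union>j. stuck (e / 2 ^ k) w j)"
  have B_null: "B \<in> null_sets \<mu>"
    unfolding B_def
  proof (intro null_sets_UN)
    fix k w j
    have "e / 2 ^ k \<le> 1"
      using order_trans[OF e(2) one_le_power[of "2::real" k]] by (simp add: field_simps)
    then have "measure \<mu> (stuck (e / 2 ^ k) w j) = 0" using e(1) by (intro stuck_null) auto
    then show "stuck (e / 2 ^ k) w j \<in> null_sets \<mu>" by (simp add: null_sets_def emeasure_eq_measure)
  qed
  have "0 < measure \<mu> (dense_part e []) - s" using E by simp
  moreover have "B \<in> sets borel" using B_null sets_\<mu> by (auto simp: null_sets_def)
  ultimately obtain U where U: "open U" "B \<subseteq> U"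
      "measure \<mu> U < measure \<mu> B + (measure \<mu> (dense_part e []) - s)"
    using cantor_outer_regular[OF finite_measure_axioms sets_\<mu>] by blast
  have [measurable]: "U \<in> sets \<mu>" using U(1) sets_\<mu> by simp
  have "measure \<mu> B = 0" using B_null by (simp add: measure_eq_0_null_sets)
  show ?thesis
  proof (intro exI conjI)
    show "closed (dense_part e [] - U)" using closed_dense_part U(1) by (rule closed_Diff)
    have "measure \<mu> (dense_part e []) \<le> measure \<mu> ((dense_part e [] - U) \<union> U)"
      by (intro finite_measure_mono) auto
    also have "\<dots> \<le> measure \<mu> (dense_part e [] - U) + measure \<mu> U"
      by (rule measure_Un_le) auto
    finally show "s < measure \<mu> (dense_part e [] - U)"
      using U(3) \<open>measure \<mu> B = 0\<close> by simp
    have "(x, y) \<notin> F" if x: "x \<in> dense_part e [] - U" for x y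
    proof -
      have "x \<notin> stuck (e / 2 ^ k) w j" for k w j using x U(2) unfolding B_def by blast
      then obtain d where "infinite (y_rounds d)" "y_digits d = y"
          "\<forall>n. 0 < M (map (\<lambda>n. (x n, d n)) [0..<n])"
        using play_digits[OF e(1), of x y] x by blast
      then show ?thesis using lose[of x d] by blast
    qed
    then show "(dense_part e [] - U) \<inter> {x. \<exists>y. (x, y) \<in> F} = {}" by blast
  qed
qed

end

section \<open>The mass assignment of a winning strategy of I\<close>

locale unfolded_winning = prob_space \<mu> for \<mu> :: "(nat \<Rightarrow> bool) measure" +
  fixes s :: real and F :: "((nat \<Rightarrow> bool) \<times> (nat \<Rightarrow> nat)) set"
    and \<sigma> :: "((real \<times> real) \<times> (bool \<times> nat option)) list \<Rightarrow> real \<times> real"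
  assumes sets_\<mu>: "sets \<mu> = sets borel"
    and winning: "\<forall>n. fst (p n) = \<sigma> (map p [0..<n]) \<Longrightarrow> \<not> unfolded_measure_game \<mu> s F p"
begin

definition hist :: "(bool \<times> nat option) list \<Rightarrow> ((real \<times> real) \<times> (bool \<times> nat option)) list" where
  "hist = foldl (\<lambda>h c. h @ [(\<sigma> h, c)]) []"

text \<open>The value of \<open>mass\<close> when I follows \<open>\<sigma>\<close>: the mass of the
  newest bit stands in the pair that I played just before it.\<close>

definition pos_mass :: "(bool \<times> nat option) list \<Rightarrow> real" where
  "pos_mass w = (if w = [] then fst (\<sigma> []) + snd (\<sigma> [])
     else if fst (last w) then snd (\<sigma> (hist (butlast w))) else fst (\<sigma> (hist (butlast w))))"

text \<open>II has broken no rule so far. The empty position is exempt, as the rule concerns masses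
  after a move of II.\<close>

definition alive :: "(bool \<times> nat option) list \<Rightarrow> bool" where
  "alive w \<longleftrightarrow> (\<forall>k<length w. pos_mass (take (Suc k) w) \<noteq> 0)"

text \<open>Once II has broken a rule, \<open>\<sigma>\<close> need not obey the rules any more, hence the cut-off.\<close>
definition alive_mass :: "(bool \<times> nat option) list \<Rightarrow> real" where
  "alive_mass w = (if alive w then pos_mass w else 0)"

lemma hist_Nil [simp]: "hist [] = []"
  by (simp add: hist_def)

lemma hist_snoc: "hist (w @ [c]) = hist w @ [(\<sigma> (hist w), c)]"
  by (simp add: hist_def)

lemma pos_mass_snoc:
  "pos_mass (w @ [c]) = (if fst c then snd (\<sigma> (hist w)) else fst (\<sigma> (hist w)))"
  by (simp add: pos_mass_def)

lemma alive_Nil [simp]: "alive []"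
  by (simp add: alive_def)

lemma alive_snoc: "alive (w @ [c]) \<longleftrightarrow> alive w \<and> pos_mass (w @ [c]) \<noteq> 0"
  by (auto simp: alive_def less_Suc_eq)

lemma mass_run:
  "mass (\<lambda>n. \<sigma> (hist (map b [0..<n]))) (\<lambda>n. fst (b n)) n = pos_mass (map b [0..<n])"
  by (cases n) (simp_all add: pos_mass_def)

text \<open>Any sequence \<open>b\<close> of moves of II, legal or not, is answered by
  \<open>\<sigma>\<close>, and \<open>winning\<close> applies to the resulting run.\<close>

lemma not_II_wins_run:
  "\<not> II_wins_run
      (I_obeys \<mu> s (\<lambda>n. \<sigma> (hist (map b [0..<n]))) (\<lambda>n. fst (b n)))
      (II_obeys (\<lambda>n. \<sigma> (hist (map b [0..<n]))) (\<lambda>n. fst (b n)))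
      (infinite (y_rounds (\<lambda>n. snd (b n))) \<and> (\<lambda>n. fst (b n), y_digits (\<lambda>n. snd (b n))) \<in> F)"
proof -
  define p where "p n = (\<sigma> (hist (map b [0..<n])), b n)" for n
  have "map p [0..<n] = hist (map b [0..<n])" for n
    by (induction n) (simp_all add: p_def hist_snoc)
  then have "\<not> unfolded_measure_game \<mu> s F p"
    by (intro winning) (simp add: p_def)
  then show ?thesis
    by (simp add: unfolded_measure_game_def p_def Let_def)
qed

lemma II_obeys_run:
  "II_obeys (\<lambda>n. \<sigma> (hist (map b [0..<n]))) (\<lambda>n. fst (b n)) k \<longleftrightarrow> pos_mass (map b [0..<Suc k]) \<noteq> 0"
  unfolding II_obeys_def mass_run ..

text \<open>Otherwise the first violation by I would be preceded by none of II, and II would win the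
  run.\<close>

lemma I_obeys_run:
  assumes "alive (map b [0..<n])"
  shows "I_obeys \<mu> s (\<lambda>n. \<sigma> (hist (map b [0..<n]))) (\<lambda>n. fst (b n)) n"
proof (rule ccontr)
  let ?I = "I_obeys \<mu> s (\<lambda>n. \<sigma> (hist (map b [0..<n]))) (\<lambda>n. fst (b n))"
  let ?II = "II_obeys (\<lambda>n. \<sigma> (hist (map b [0..<n]))) (\<lambda>n. fst (b n))"
  assume nI: "\<not> ?I n"
  define m where "m = (LEAST m. \<not> ?I m)"
  have "\<not> ?I m" unfolding m_def using nI by (rule LeastI)
  moreover have "m \<le> n" unfolding m_def using nI by (rule Least_le)
  moreover have "?I k" if "k < m" for k using not_less_Least that unfolding m_def by blast
  moreover have "?II k" if "k < n" for k
  proof -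
    have "take (Suc k) (map b [0..<n]) = map b [0..<Suc k]"
      using that by (simp add: take_map del: upt_Suc)
    then show ?thesis using assms that unfolding II_obeys_run alive_def by (auto simp del: upt_Suc)
  qed
  ultimately have "\<exists>m. \<not> ?I m \<and> (\<forall>k<m. ?I k \<and> ?II k)"
    by (intro exI[of _ m]) auto
  then show False using not_II_wins_run[of b] unfolding II_wins_run_def by blast
qed

lemma alive_rules:
  assumes "alive w"
  shows "mass_ok \<mu> (map fst w) (pos_mass w)"
    and "mass_ok \<mu> (map fst w @ [False]) (fst (\<sigma> (hist w)))"
    and "mass_ok \<mu> (map fst w @ [True]) (snd (\<sigma> (hist w)))"
    and "fst (\<sigma> (hist w)) + snd (\<sigma> (hist w)) = pos_mass w"
    and "w = [] \<Longrightarrow> s < pos_mass w"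
proof -
  \<comment> \<open>The padding is arbitrary: the rules for I in round \<open>length w\<close>
    depend only on the earlier moves of II.\<close>
  define b where "b n = (if n < length w then w ! n else (False, None))" for n
  have b: "map b [0..<length w] = w"
    by (rule nth_equalityI) (simp_all add: b_def)
  have x: "restr (\<lambda>n. fst (b n)) (length w) = map fst w"
  proof -
    have "restr (\<lambda>n. fst (b n)) (length w) = map fst (map b [0..<length w])"
      by (simp add: restr_def)
    then show ?thesis unfolding b .
  qed
  have "alive (map b [0..<length w])" using assms unfolding b .
  note rules = I_obeys_run[OF this, unfolded I_obeys_def mass_run x b]
  show "mass_ok \<mu> (map fst w) (pos_mass w)" "mass_ok \<mu> (map fst w @ [False]) (fst (\<sigma> (hist w)))"
    "mass_ok \<mu> (map fst w @ [True]) (snd (\<sigma> (hist w)))"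
    "fst (\<sigma> (hist w)) + snd (\<sigma> (hist w)) = pos_mass w"
    using rules by auto
  show "w = [] \<Longrightarrow> s < pos_mass w"
    using rules by (simp add: pos_mass_def)
qed

text \<open>A successor of an alive position dies only when its mass is 0, so the cut-off changes no
  mass there and additivity survives.\<close>

lemma alive_mass_snoc:
  "alive_mass (w @ [c]) = (if \<not> alive w then 0 else if fst c then snd (\<sigma> (hist w)) else fst (\<sigma> (hist w)))"
  by (simp add: alive_mass_def alive_snoc pos_mass_snoc)

lemma mass_strategy_alive_mass: "mass_strategy \<mu> alive_mass"
proof unfold_locales
  fix w :: "(bool \<times> nat option) list" and b d
  show "sets \<mu> = sets borel" by (rule sets_\<mu>)
  show "0 \<le> alive_mass w" "alive_mass w \<le> prob (cyl (map fst w))"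
    using alive_rules(1)[of w] by (auto simp: alive_mass_def mass_ok_def)
  show "alive_mass (w @ [(False, d)]) + alive_mass (w @ [(True, d)]) = alive_mass w"
    using alive_rules(4)[of w] by (simp add: alive_mass_snoc) (simp add: alive_mass_def)
  show "alive_mass (w @ [(b, d)]) = alive_mass (w @ [(b, None)])"
    by (simp add: alive_mass_snoc)
qed

sublocale mass_strategy \<mu> alive_mass
  by (rule mass_strategy_alive_mass)

text \<open>Positive masses along a run mean that neither player breaks a rule, so with infinitely
  many digits \<open>\<sigma>\<close> can win only because the pair lies outside
  \<open>F\<close>.\<close>

lemma I_wins_measure_game:
  assumes "0 \<le> s"
  shows "I_has_winning_strategy (measure_game \<mu> s {x. \<exists>y. (x, y) \<in> F})"
proof -
  have "s < alive_mass []"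
    using alive_rules(5)[of "[]"] by (simp add: alive_mass_def)
  moreover have "(x, y_digits d) \<notin> F"
    if pos: "\<And>n. 0 < alive_mass (map (\<lambda>n. (x n, d n)) [0..<n])"
      and inf: "infinite (y_rounds d)" for x d
  proof -
    let ?b = "\<lambda>n. (x n, d n)"
    have alive: "alive (map ?b [0..<n])" and "pos_mass (map ?b [0..<n]) \<noteq> 0" for n
      using pos[of n] by (auto simp: alive_mass_def split: if_splits)
    then show ?thesis
      using not_II_wins_run[of ?b] I_obeys_run[OF alive] inf
      unfolding II_wins_run_def II_obeys_run by (auto simp del: upt_Suc)
  qed
  ultimately obtain C where "closed C" "C \<inter> {x. \<exists>y. (x, y) \<in> F} = {}" "s < prob C"
    using closed_set_avoiding_projection[of s F] by blast
  then show ?thesis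
    using I_wins_if_closed_set[OF prob_space_axioms sets_\<mu>] assms by blast
qed

end

theorem theorem5p2:
  fixes \<mu> :: "(nat \<Rightarrow> bool) measure" and s :: real
    and F :: "((nat \<Rightarrow> bool) \<times> (nat \<Rightarrow> nat)) set" and A :: "(nat \<Rightarrow> bool) set"
  assumes "prob_space \<mu>" and "sets \<mu> = sets borel"
    and "s \<in> {0..<1}"
    and "A = {x. \<exists>y. (x, y) \<in> F}"
  shows "(I_has_winning_strategy (unfolded_measure_game \<mu> s F) \<longrightarrow>
            I_has_winning_strategy (measure_game \<mu> s A)) \<and>
         (II_has_winning_strategy (unfolded_measure_game \<mu> s F) \<longrightarrow>
            II_has_winning_strategy (measure_game \<mu> s A))"
proof (intro conjI impI)
  assume "I_has_winning_strategy (unfolded_measure_game \<mu> s F)"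
  then obtain \<sigma> where "\<And>p. \<forall>n. fst (p n) = \<sigma> (map p [0..<n]) \<Longrightarrow> \<not> unfolded_measure_game \<mu> s F p"
    unfolding I_has_winning_strategy_def by blast
  then have "unfolded_winning \<mu> s F \<sigma>"
    using assms(1,2) by (simp add: unfolded_winning_def unfolded_winning_axioms_def)
  then show "I_has_winning_strategy (measure_game \<mu> s A)"
    using unfolded_winning.I_wins_measure_game assms(3,4) by auto
next
  assume "II_has_winning_strategy (unfolded_measure_game \<mu> s F)"
  then show "II_has_winning_strategy (measure_game \<mu> s A)"
    unfolding assms(4) by (rule II_measure_game_if_II_unfolded)
qed

end
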